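(* Let $(X,\sigma)$ be a subshift over a finite alphabet and suppose there exists $k\in\mathbb{N}$ such that $$\liminf_{n\to\infty}\frac{P_X(n)}{n}<k.$$ Then $(X,\sigma)$ has at most $k-1$ distinct, nonatomic, generic measures.
   Context: A subshift $(X,\sigma)$ is a closed subset $X\subset\mathcal{A}^{\mathbb{Z}}$, where $\mathcal{A}$ is a finite alphabet with the discrete topology and $\mathcal{A}^{\mathbb{Z}}$ has the product topology, that is invariant under the left shift $\sigma\colon\mathcal{A}^{\mathbb{Z}}\to\mathcal{A}^{\mathbb{Z}}$, $(\sigma x)(n)=x(n+1)$. The complexity function $P_X(n)$ is the number of distinct words of length $n$ that occur as (contiguous) subwords of elements of $X$. Let $\mu$ be a $\sigma$-invariant Borel probability measure on $X$. A point $x\in X$ is generic for $\mu$ if for every continuous $f\colon X\to\mathbb{R}$, $$\lim_{N\to\infty}\frac1N\sum_{n=0}^{N-1}f(\sigma^n x)=\int f\,d\mu.$$ The measure $\mu$ is called generic if it has a generic point in $X$. A generic measure need not be ergodic. A measure is nonatomic if every point has measure zero. *)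

theory Defs
  imports "HOL-Probability.Probability"
begin

text \<open>
  The alphabet is a finite set \<open>A\<close> of letters taken from a type with the discrete topology
  (class \<^class>\<open>discrete_topology\<close>). Bi-infinite sequences are functions \<open>int \<Rightarrow> 'a\<close>; the topology
  that the library puts on this function type is the product topology.
\<close>

definition shift :: "(int \<Rightarrow> 'a) \<Rightarrow> (int \<Rightarrow> 'a)" where
  "shift x = (\<lambda>n. x (n + 1))"

text \<open>
  The set \<open>UNIV \<rightarrow> A\<close> is closed, so closed in \<open>int \<Rightarrow> 'a\<close> and closed in \<open>UNIV \<rightarrow> A\<close> agree for
  its subsets. Invariance is required only in the form \<open>\<sigma>(X) \<subseteq> X\<close>; this includes the
  subshifts with \<open>\<sigma>(X) = X\<close>.
\<close>

definition subshift :: "'a::discrete_topology set \<Rightarrow> (int \<Rightarrow> 'a) set \<Rightarrow> bool" where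
  "subshift A X \<longleftrightarrow> finite A \<and> X \<subseteq> UNIV \<rightarrow> A \<and> closed X \<and> shift ` X \<subseteq> X"

definition words :: "(int \<Rightarrow> 'a) set \<Rightarrow> nat \<Rightarrow> 'a list set" where
  "words X n = {map (\<lambda>j. x (i + int j)) [0..<n] | x i. x \<in> X}"

definition complexity :: "(int \<Rightarrow> 'a) set \<Rightarrow> nat \<Rightarrow> nat" where
  "complexity X n = card (words X n)"

text \<open>A measure on \<open>X\<close> has \<open>X\<close> itself, not all of \<open>int \<Rightarrow> 'a\<close>, as its underlying space.\<close>

definition invariant_prob :: "(int \<Rightarrow> 'a::discrete_topology) set \<Rightarrow> (int \<Rightarrow> 'a) measure \<Rightarrow> bool" where
  "invariant_prob X \<mu> \<longleftrightarrow>
     prob_space \<mu> \<and> sets \<mu> = sets (restrict_space borel X) \<and>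
     (\<forall>B\<in>sets \<mu>. emeasure \<mu> (shift -` B \<inter> space \<mu>) = emeasure \<mu> B)"

definition generic_point ::
    "(int \<Rightarrow> 'a::discrete_topology) set \<Rightarrow> (int \<Rightarrow> 'a) measure \<Rightarrow> (int \<Rightarrow> 'a) \<Rightarrow> bool" where
  "generic_point X \<mu> x \<longleftrightarrow> x \<in> X \<and>
     (\<forall>f :: (int \<Rightarrow> 'a) \<Rightarrow> real. continuous_on X f \<longrightarrow>
        (\<lambda>N. (1 / real N) * (\<Sum>n<N. f ((shift ^^ n) x))) \<longlonglongrightarrow> (\<integral>y. f y \<partial>\<mu>))"

definition generic_measure ::
    "(int \<Rightarrow> 'a::discrete_topology) set \<Rightarrow> (int \<Rightarrow> 'a) measure \<Rightarrow> bool" where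
  "generic_measure X \<mu> \<longleftrightarrow> invariant_prob X \<mu> \<and> (\<exists>x. generic_point X \<mu> x)"

definition nonatomic :: "'b measure \<Rightarrow> bool" where
  "nonatomic \<mu> \<longleftrightarrow> (\<forall>x\<in>space \<mu>. emeasure \<mu> {x} = 0)"

end

theory Submission
  imports Defs
begin

text \<open>
  Let \<open>x\<^sub>1, \<dots>, x\<^sub>k\<close> be generic for distinct nonatomic measures, and let \<open>P(n) < c n\<close> with \<open>c < k\<close>
  for infinitely many \<open>n\<close>. Fix a small \<open>\<delta> > 0\<close>. No \<open>x\<^sub>i\<close> is eventually periodic to the right, and a
  variant of the Morse--Hedlund argument then yields at least \<open>(1 - \<delta>) n\<close> words of length \<open>n\<close> in
  \<open>x\<^sub>i\<close> whose prefix of length \<open>\<delta> n\<close> already occurs in \<open>x\<^sub>i\<close> at some position below \<open>n\<close>. At such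
  positions genericity controls the word statistics of windows of length \<open>\<delta> n\<close>, since these are
  differences of two initial Birkhoff sums of length \<open>O(n)\<close>. For large \<open>n\<close> the prefixes therefore
  identify the measure, the \<open>k\<close> families of words are disjoint, and \<open>P(n) \<ge> k (1 - \<delta>) n > c n\<close>.
\<close>

section \<open>Counting factors of a one-sided sequence\<close>

text \<open>Words are read off the forward half only, since Birkhoff averages follow the forward
  orbit.\<close>

definition factor :: "(nat \<Rightarrow> 'a) \<Rightarrow> nat \<Rightarrow> nat \<Rightarrow> 'a list" where
  "factor z i n = map (\<lambda>j. z (i + j)) [0..<n]"

lemma factor_eq_iff: "factor z i n = factor z' i' n \<longleftrightarrow> (\<forall>j<n. z (i + j) = z' (i' + j))"
  by (auto simp: factor_def list_eq_iff_nth_eq)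

lemma take_factor: "m \<le> n \<Longrightarrow> take m (factor z i n) = factor z i m"
  by (simp add: factor_def take_map)

text \<open>Shifting a window left by one period keeps its letters while it stays inside
  \<open>{p..<b}\<close>; repeating this brings its start into the first period.\<close>

lemma periodic_factor_reduce:
  assumes per: "\<And>r. p \<le> r \<Longrightarrow> r + t < b \<Longrightarrow> z (r + t) = z r" and "t > 0"
    and "p \<le> i" "i + m \<le> b"
  shows "\<exists>s. p \<le> s \<and> s < p + t \<and> factor z s m = factor z i m"
  using assms(3,4)
proof (induction i rule: less_induct)
  case (less i)
  show ?case
  proof (cases "i < p + t")
    case True
    then show ?thesis using less.prems by blast
  next
    case False
    have "factor z (i - t) m = factor z i m"
      unfolding factor_eq_iff
    proof (intro allI impI)
      fix j assume "j < m"
      with per[of "i - t + j"] False less.prems \<open>t > 0\<close> show "z (i - t + j) = z (i + j)"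
        by simp
    qed
    moreover have "\<exists>s. p \<le> s \<and> s < p + t \<and> factor z s m = factor z (i - t) m"
      using less.IH[of "i - t"] False less.prems \<open>t > 0\<close> by simp
    ultimately show ?thesis by simp
  qed
qed

text \<open>
  If two of the first \<open>n\<close> factors agree, then \<open>z\<close> is periodic, with a period \<open>t < n\<close>, on an interval
  that ends at some \<open>b\<close>. Factors across \<open>b\<close> are told apart by where the period breaks; together
  with the \<open>t\<close> periodic factors they replace the first \<open>n\<close> factors. However far away \<open>b\<close> is,
  their prefixes that stay left of \<open>b\<close> also occur near the origin.
\<close>

lemma many_factors:
  fixes z :: "nat \<Rightarrow> 'a"
  assumes aper: "\<And>p t. t > 0 \<Longrightarrow> \<exists>r\<ge>p. z (r + t) \<noteq> z r" and "m \<le> n"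
  shows "\<exists>W. finite W \<and> n - m \<le> card W \<and>
             (\<forall>w\<in>W. \<exists>i. w = factor z i n) \<and> (\<forall>w\<in>W. \<exists>s<n. take m w = factor z s m)"
proof (cases "inj_on (\<lambda>i. factor z i n) {..<n}")
  case True
  then have "card ((\<lambda>i. factor z i n) ` {..<n}) = n"
    by (simp add: card_image)
  then show ?thesis using \<open>m \<le> n\<close>
    by (intro exI[of _ "(\<lambda>i. factor z i n) ` {..<n}"]) (auto simp: take_factor)
next
  case False
  define R where "R t \<longleftrightarrow> t > 0 \<and> (\<exists>p. p + t < n \<and> factor z p n = factor z (p + t) n)" for t
  \<comment> \<open>The least distance between two equal factors starting below \<open>n\<close>;
    minimality makes the factors starting within one period distinct.\<close>
  define t where "t = (LEAST t. R t)"
  obtain i i' where "i < i'" "i' < n" "factor z i n = factor z i' n"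
    using False by (auto simp: inj_on_def) (metis nat_neq_iff)
  then have "R (i' - i)"
    by (auto simp: R_def intro!: exI[of _ i])
  then have "R t" and min: "\<And>u. R u \<Longrightarrow> t \<le> u"
    unfolding t_def by (auto intro: LeastI Least_le)
  then obtain p where t: "t > 0" "p + t < n" "factor z p n = factor z (p + t) n"
    by (auto simp: R_def)
  define r where "r = (LEAST r. p \<le> r \<and> z (r + t) \<noteq> z r)"
  have "\<exists>r. p \<le> r \<and> z (r + t) \<noteq> z r"
    using aper[OF t(1)] by blast
  then have r: "p \<le> r" "z (r + t) \<noteq> z r" and below: "\<And>u. p \<le> u \<Longrightarrow> u < r \<Longrightarrow> z (u + t) = z u"
    unfolding r_def by (metis (mono_tags, lifting) LeastI, metis (mono_tags, lifting) LeastI,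
        metis (mono_tags, lifting) not_less_Least)
  define b where "b = r + t"
  have per: "z (u + t) = z u" if "p \<le> u" "u + t < b" for u
    using below that by (simp add: b_def)
  \<comment> \<open>The equal factors at \<open>p\<close> and \<open>p + t\<close> confirm the
    period at \<open>n\<close> places, so it first fails at some
    \<open>r \<ge> p + n\<close>.\<close>
  have b: "p + t + n \<le> b"
  proof (rule ccontr)
    assume "\<not> ?thesis"
    then have "r - p < n" using r by (simp add: b_def)
    with t(3) r(1) have "z r = z (r + t)"
      by (auto simp: factor_eq_iff add.commute add.left_commute dest!: spec[of _ "r - p"])
    with r(2) show False by simp
  qed
  define I where "I = {p..<p + t}"
  \<comment> \<open>The open left end makes windows starting in \<open>J\<close> contain
    \<open>b\<close>; the bound \<open>t\<close> makes them contain \<open>r = b - t\<close> as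
    well, and the bound \<open>m\<close> keeps their first \<open>m\<close> letters left of
    \<open>b\<close>.\<close>
  define J where "J = {b - n<..b - max t m}"
  \<comment> \<open>At the two offsets where the window at \<open>i'\<close> shows \<open>r\<close>
    and \<open>b\<close>, the window at the earlier \<open>i\<close> still lies in the periodic
    stretch: there the two letters agree, at \<open>i'\<close> they differ.\<close>
  have far: "factor z i n \<noteq> factor z i' n" if "i < i'" "p \<le> i" "i' \<in> J" for i i'
  proof
    assume eq: "factor z i n = factor z i' n"
    define j where "j = b - i'"
    have j: "t \<le> j" "j < n" "i' + j = b" "i' + (j - t) = r"
      using that b by (auto simp: J_def j_def b_def)
    have same: "z (i + l) = z (i' + l)" if "l < n" for l
      using eq that by (simp add: factor_eq_iff)
    have "z (i + j) = z (i' + j)" "z (i + (j - t)) = z (i' + (j - t))"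
      using j by (auto intro!: same simp del: add_diff_assoc)
    moreover have "z (i + j) = z (i + (j - t))"
      using per[of "i + (j - t)"] that j by simp
    ultimately show False using r(2) j by (simp add: b_def)
  qed
  have near: "factor z i n \<noteq> factor z i' n" if "i < i'" "i \<in> I" "i' \<in> I" for i i'
  proof
    assume "factor z i n = factor z i' n"
    then have "R (i' - i)" using that t(2) by (auto simp: R_def I_def intro!: exI[of _ i])
    with min that show False by (fastforce simp: I_def)
  qed
  have IJ: "i < i'" if "i \<in> I" "i' \<in> J" for i i'
    using that b by (auto simp: I_def J_def)
  have "factor z i n \<noteq> factor z i' n" if "i < i'" "i \<in> I \<union> J" "i' \<in> I \<union> J" for i i'
  proof -
    have "p \<le> i" using that b by (auto simp: I_def J_def)
    then show ?thesis using that far[of i i'] near[of i i'] IJ[of i' i] by force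
  qed
  then have inj: "inj_on (\<lambda>i. factor z i n) (I \<union> J)"
    by (intro inj_onI) (metis nat_neq_iff)
  have "I \<inter> J = {}" using IJ by fastforce
  \<comment> \<open>The total is \<open>n\<close> if \<open>t \<ge> m\<close>, and
    \<open>n - m + t\<close> otherwise.\<close>
  then have "card (I \<union> J) = t + (n - max t m)"
    using b \<open>m \<le> n\<close> t by (subst card_Un_disjoint) (auto simp: I_def J_def)
  then have "n - m \<le> card (I \<union> J)"
    using t by simp
  moreover have "\<exists>s<n. take m (factor z i n) = factor z s m" if "i \<in> I \<union> J" for i
  proof -
    have "p \<le> i" "i + m \<le> b"
      using that b \<open>m \<le> n\<close> by (auto simp: I_def J_def)
    from periodic_factor_reduce[of p t b z, OF per t(1) this] \<open>m \<le> n\<close> t(2) show ?thesis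
      by (metis take_factor less_trans)
  qed
  ultimately show ?thesis using inj
    by (intro exI[of _ "(\<lambda>i. factor z i n) ` (I \<union> J)"]) (auto simp: card_image I_def J_def)
qed

section \<open>Birkhoff averages over windows\<close>

text \<open>A window sum is the difference of the initial sums up to \<open>s + m\<close> and up to
  \<open>s\<close>, each with sublinear error. Since \<open>s \<le> n \<le> m / \<delta>\<close>,
  both errors are small compared with \<open>m\<close>, uniformly in \<open>s\<close>.\<close>

lemma cesaro_window:
  fixes g :: "nat \<Rightarrow> real"
  assumes lim: "(\<lambda>N. (1 / real N) * (\<Sum>n<N. g n)) \<longlonglongrightarrow> \<alpha>" and "\<delta> > 0" "\<epsilon> > 0"
  shows "\<forall>\<^sub>F n in sequentially. \<forall>s\<le>n. \<forall>m. \<delta> * real n \<le> real m \<longrightarrow>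
           \<bar>(\<Sum>r<m. g (s + r)) - real m * \<alpha>\<bar> \<le> \<epsilon> * real m"
proof -
  define D where "D N = \<bar>(\<Sum>n<N. g n) - real N * \<alpha>\<bar>" for N
  \<comment> \<open>With \<open>s \<le> m / \<delta>\<close> this makes
    \<open>\<eta> * (2 * s + m)\<close> at most \<open>\<epsilon> * m / 2\<close>; the other half is
    left for \<open>2 * K\<close>.\<close>
  define \<eta> where "\<eta> = \<epsilon> / (2 * (2 / \<delta> + 1))"
  have "\<eta> > 0" using assms by (simp add: \<eta>_def add_pos_pos)
  obtain N0 where N0: "\<And>N. N \<ge> N0 \<Longrightarrow> \<bar>(1 / real N) * (\<Sum>n<N. g n) - \<alpha>\<bar> < \<eta>"
    using LIMSEQ_D[OF lim \<open>\<eta> > 0\<close>] by auto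
  \<comment> \<open>Absorbs the finitely many initial sums over which the limit gives no
    control.\<close>
  define K where "K = (\<Sum>N\<le>N0. D N)"
  have "K \<ge> 0" by (auto simp: K_def D_def intro: sum_nonneg)
  have D: "D N \<le> \<eta> * real N + K" for N
  proof (cases "N \<le> N0")
    case True
    then have "D N \<le> K" unfolding K_def
      by (intro member_le_sum) (auto simp: D_def)
    then show ?thesis using \<open>\<eta> > 0\<close> by (simp add: add_increasing)
  next
    case False
    then have "real N > 0" by simp
    have "D N = real N * \<bar>(1 / real N) * (\<Sum>n<N. g n) - \<alpha>\<bar>"
    proof -
      have "(\<Sum>n<N. g n) - real N * \<alpha> = real N * ((1 / real N) * (\<Sum>n<N. g n) - \<alpha>)"
        using \<open>real N > 0\<close> by (simp add: field_simps)
      then show ?thesis by (simp only: D_def abs_mult abs_of_nat)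
    qed
    also have "\<dots> \<le> real N * \<eta>"
      using N0[of N] False by (intro mult_left_mono) auto
    finally show ?thesis using \<open>K \<ge> 0\<close> by (simp add: mult.commute)
  qed
  have "\<forall>\<^sub>F n in sequentially. 4 * K / (\<epsilon> * \<delta>) \<le> real n"
    by (rule eventually_sequentiallyI[of "nat \<lceil>4 * K / (\<epsilon> * \<delta>)\<rceil>"]) linarith
  then show ?thesis
  proof eventually_elim
    case (elim n)
    show ?case
    proof (intro allI impI)
      fix s m assume "s \<le> n" and m: "\<delta> * real n \<le> real m"
      have "4 * K \<le> \<epsilon> * (\<delta> * real n)"
        using elim assms by (simp add: field_simps)
      also have "\<dots> \<le> \<epsilon> * real m" using m assms by (intro mult_left_mono) auto
      finally have K: "2 * K \<le> \<epsilon> * real m / 2" by simp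
      have "real s \<le> real m / \<delta>"
      proof -
        have "\<delta> * real s \<le> \<delta> * real n" using \<open>s \<le> n\<close> assms by (intro mult_left_mono) auto
        also note m
        finally show ?thesis using assms by (simp add: field_simps)
      qed
      then have "\<eta> * (2 * real s + real m) \<le> \<eta> * (2 * (real m / \<delta>) + real m)"
        using \<open>\<eta> > 0\<close> by (intro mult_left_mono) auto
      also have "\<dots> = \<eta> * (2 / \<delta> + 1) * real m" by (simp add: algebra_simps)
      also have "\<eta> * (2 / \<delta> + 1) = \<epsilon> / 2"
      proof -
        have "\<epsilon> / (2 * q) * q = \<epsilon> / 2" if "q > 0" for q :: real
          using that by simp
        moreover have "2 / \<delta> + 1 > 0" using \<open>\<delta> > 0\<close> by (simp add: add_pos_pos)
        ultimately show ?thesis unfolding \<eta>_def by blast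
      qed
      finally have e: "\<eta> * (2 * real s + real m) \<le> \<epsilon> * real m / 2" by simp
      have split: "(\<Sum>r<s + m. g r) = (\<Sum>r<s. g r) + (\<Sum>r<m. g (s + r))"
        by (induction m) auto
      have "\<bar>(\<Sum>r<m. g (s + r)) - real m * \<alpha>\<bar> \<le> D (s + m) + D s"
        unfolding D_def split by (simp add: algebra_simps abs_if)
      also have "\<dots> \<le> \<eta> * (2 * real s + real m) + 2 * K"
        using D[of "s + m"] D[of s] by (simp add: algebra_simps)
      finally show "\<bar>(\<Sum>r<m. g (s + r)) - real m * \<alpha>\<bar> \<le> \<epsilon> * real m" using e K by simp
    qed
  qed
qed

text \<open>Agreement outside two margins of length \<open>L\<close> would put the window sums
  within \<open>2 * L\<close> of each other, but they are close to \<open>m * \<alpha>\<close> and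
  \<open>m * \<beta>\<close>. In the margins a cylinder of radius \<open>L\<close> may look outside
  the window.\<close>

lemma cesaro_windows_differ:
  fixes g h :: "nat \<Rightarrow> real"
  assumes g: "(\<lambda>N. (1 / real N) * (\<Sum>n<N. g n)) \<longlonglongrightarrow> \<alpha>"
    and h: "(\<lambda>N. (1 / real N) * (\<Sum>n<N. h n)) \<longlonglongrightarrow> \<beta>"
    and "\<alpha> \<noteq> \<beta>" "\<delta> > 0"
    and bounded: "\<And>n. g n \<in> {0..1}" "\<And>n. h n \<in> {0..1}"
  shows "\<forall>\<^sub>F n in sequentially. \<forall>s\<le>n. \<forall>s'\<le>n. \<forall>m. \<delta> * real n \<le> real m \<longrightarrow>
           (\<exists>r. L \<le> r \<and> r + L < m \<and> g (s + r) \<noteq> h (s' + r))"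
proof -
  \<comment> \<open>The gap \<open>4 * \<epsilon> * m\<close> exceeds the two errors
    \<open>\<epsilon> * m\<close> by \<open>2 * \<epsilon> * m\<close>, which the threshold on
    \<open>n\<close> makes larger than \<open>2 * L\<close>.\<close>
  define \<epsilon> where "\<epsilon> = \<bar>\<alpha> - \<beta>\<bar> / 4"
  have "\<epsilon> > 0" using \<open>\<alpha> \<noteq> \<beta>\<close> by (simp add: \<epsilon>_def)
  have "\<forall>\<^sub>F n in sequentially. (2 * real L + 1) / (\<epsilon> * \<delta>) \<le> real n"
    by (rule eventually_sequentiallyI[of "nat \<lceil>(2 * real L + 1) / (\<epsilon> * \<delta>)\<rceil>"]) linarith
  with cesaro_window[OF g \<open>\<delta> > 0\<close> \<open>\<epsilon> > 0\<close>] cesaro_window[OF h \<open>\<delta> > 0\<close> \<open>\<epsilon> > 0\<close>] show ?thesis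
  proof eventually_elim
    case (elim n)
    show ?case
    proof (intro allI impI, rule ccontr)
      fix s s' m assume s: "s \<le> n" "s' \<le> n" and m: "\<delta> * real n \<le> real m"
        and "\<not> (\<exists>r. L \<le> r \<and> r + L < m \<and> g (s + r) \<noteq> h (s' + r))"
      then have eq: "g (s + r) = h (s' + r)" if "L \<le> r" "r + L < m" for r
        using that by blast
      \<comment> \<open>If \<open>m < L\<close>, truncated subtraction only shortens the right
        margin.\<close>
      define B where "B = {..<L} \<union> {m - L..<m}"
      have "\<bar>(\<Sum>r<m. g (s + r)) - (\<Sum>r<m. h (s' + r))\<bar> \<le> (\<Sum>r<m. \<bar>g (s + r) - h (s' + r)\<bar>)"
        by (simp add: sum_subtractf[symmetric] sum_abs)
      also have "\<dots> \<le> (\<Sum>r<m. indicator B r)"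
      proof (rule sum_mono)
        fix r assume "r \<in> {..<m}"
        then show "\<bar>g (s + r) - h (s' + r)\<bar> \<le> indicator B r"
          using eq[of r] bounded(1)[of "s + r"] bounded(2)[of "s' + r"]
          by (auto simp: B_def indicator_def abs_if)
      qed
      also have "\<dots> = real (card ({..<m} \<inter> B))"
        by (simp add: indicator_def sum.If_cases)
      also have "\<dots> \<le> real (card B)"
        by (intro of_nat_mono card_mono) (auto simp: B_def)
      also have "\<dots> \<le> 2 * real L"
        using card_Un_le[of "{..<L}" "{m - L..<m}"] by (simp add: B_def)
      finally have "\<bar>(\<Sum>r<m. g (s + r)) - (\<Sum>r<m. h (s' + r))\<bar> \<le> 2 * real L" .
      moreover have "\<bar>(\<Sum>r<m. g (s + r)) - real m * \<alpha>\<bar> \<le> \<epsilon> * real m"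
        "\<bar>(\<Sum>r<m. h (s' + r)) - real m * \<beta>\<bar> \<le> \<epsilon> * real m"
        using elim s m by blast+
      ultimately have "\<bar>real m * \<alpha> - real m * \<beta>\<bar> \<le> 2 * (\<epsilon> * real m) + 2 * real L"
        by linarith
      moreover have "\<bar>real m * \<alpha> - real m * \<beta>\<bar> = 4 * (\<epsilon> * real m)"
        by (simp add: \<epsilon>_def right_diff_distrib[symmetric] abs_mult)
      ultimately have "\<epsilon> * real m \<le> real L" by simp
      moreover have "2 * real L + 1 \<le> \<epsilon> * (\<delta> * real n)"
        using elim(3) \<open>\<epsilon> > 0\<close> \<open>\<delta> > 0\<close> by (simp add: field_simps)
      moreover have "\<epsilon> * (\<delta> * real n) \<le> \<epsilon> * real m"
        using m \<open>\<epsilon> > 0\<close> by (intro mult_left_mono) auto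
      ultimately show False by simp
    qed
  qed
qed

section \<open>Cylinders determine the measure\<close>

text \<open>Windows centred at 0 make any two cylinders nested or disjoint, and every point of a
  cylinder can serve as its \<open>v\<close>.\<close>

definition cylinder :: "nat \<Rightarrow> (int \<Rightarrow> 'a) \<Rightarrow> (int \<Rightarrow> 'a) set" where
  "cylinder L v = {y. \<forall>j. \<bar>j\<bar> \<le> int L \<longrightarrow> y j = v j}"

lemma cylinder_altdef: "cylinder L v = (\<Inter>j\<in>{- int L..int L}. (\<lambda>y. y j) -` {v j})"
  by (auto simp: cylinder_def abs_le_iff)

lemma open_cylinder: "open (cylinder L (v :: int \<Rightarrow> 'a::discrete_topology))"
  unfolding cylinder_altdef
  by (intro open_INT finite_atLeastAtMost_int ballI open_vimage)
    (auto simp: discrete_topology_class.open_discrete continuous_on_product_coordinates)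

lemma closed_cylinder: "closed (cylinder L (v :: int \<Rightarrow> 'a::discrete_topology))"
  unfolding cylinder_altdef
  by (intro closed_INT ballI closed_vimage)
    (auto simp: closed_def discrete_topology_class.open_discrete continuous_on_product_coordinates)

text \<open>Cylinders are clopen; this makes their indicators admissible test functions for
  genericity.\<close>

lemma continuous_on_indicator_cylinder:
  "continuous_on X (indicator (cylinder L (v :: int \<Rightarrow> 'a::discrete_topology)) :: _ \<Rightarrow> real)"
proof -
  let ?C = "cylinder L v"
  have "continuous_on (?C \<union> - ?C) (\<lambda>y. if y \<in> ?C then 1 else 0 :: real)"
    using open_cylinder[of L v] closed_cylinder[of L v]
    by (intro continuous_on_If) (auto simp: closed_Compl)
  moreover have "indicator ?C = (\<lambda>y. if y \<in> ?C then 1 else 0 :: real)"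
    by (auto simp: indicator_def)
  ultimately show ?thesis
    by (metis Compl_partition continuous_on_subset subset_UNIV)
qed

lemma open_contains_cylinder:
  fixes y :: "int \<Rightarrow> 'a::discrete_topology"
  assumes "open U" "y \<in> U"
  shows "\<exists>L. cylinder L y \<subseteq> U"
proof -
  have "openin (product_topology (\<lambda>i. euclidean) UNIV) U"
    using \<open>open U\<close> by (simp add: open_fun_def)
  from product_topology_open_contains_basis[OF this \<open>y \<in> U\<close>] obtain V
    where V: "y \<in> Pi\<^sub>E UNIV V" "finite {i. V i \<noteq> UNIV}" "Pi\<^sub>E UNIV V \<subseteq> U"
    by auto
  \<comment> \<open>The sum is a crude bound for the largest restricted coordinate, valid also if
    there is none.\<close>
  define L where "L = (\<Sum>i\<in>{i. V i \<noteq> UNIV}. nat \<bar>i\<bar>)"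
  have L: "\<bar>i\<bar> \<le> int L" if "V i \<noteq> UNIV" for i
    proof -
    have "nat \<bar>i\<bar> \<le> L"
      unfolding L_def using V(2) that by (intro member_le_sum) auto
    then show ?thesis by linarith
  qed
  have "w \<in> Pi\<^sub>E UNIV V" if "w \<in> cylinder L y" for w
  proof (clarsimp simp: PiE_UNIV_domain)
    fix i show "w i \<in> V i"
      using L[of i] V(1) that by (cases "V i = UNIV") (auto simp: cylinder_def)
  qed
  with V(3) show ?thesis by blast
qed

lemma space_invariant_prob: "invariant_prob X \<mu> \<Longrightarrow> space \<mu> = X"
  by (auto simp: invariant_prob_def space_restrict_space dest!: sets_eq_imp_space_eq)

lemma cylinder_measurable:
  "invariant_prob X \<mu> \<Longrightarrow> cylinder L v \<inter> X \<in> sets \<mu>"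
  by (auto simp: invariant_prob_def sets_restrict_space open_cylinder)

text \<open>The traces of cylinders on \<open>X\<close>, with \<open>{}\<close> added for disjoint
  pairs, form a countable intersection-stable generator of the Borel sets.\<close>

lemma invariant_prob_eqI:
  assumes X: "subshift A X" and \<mu>: "invariant_prob X \<mu>" and \<nu>: "invariant_prob X \<nu>"
    and eq: "\<And>L v. measure \<mu> (cylinder L v \<inter> X) = measure \<nu> (cylinder L v \<inter> X)"
  shows "\<mu> = \<nu>"
proof -
  interpret \<mu>: prob_space \<mu> using \<mu> by (simp add: invariant_prob_def)
  interpret \<nu>: prob_space \<nu> using \<nu> by (simp add: invariant_prob_def)
  define E where "E = insert {} {cylinder L v \<inter> X | L v. True}"
  have "finite A" and XA: "\<And>y j. y \<in> X \<Longrightarrow> y j \<in> A" and "closed X"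
    using X by (auto simp: subshift_def)
  have "Int_stable E"
  proof (rule Int_stableI)
    fix P Q assume PQ: "P \<in> E" "Q \<in> E"
    show "P \<inter> Q \<in> E"
    proof (cases "P \<inter> Q = {}")
      case False
      then obtain w where w: "w \<in> P \<inter> Q" by blast
      with PQ obtain L v L' v' where P: "P = cylinder L v \<inter> X" "Q = cylinder L' v' \<inter> X"
        by (auto simp: E_def)
      have "P \<inter> Q = cylinder (max L L') w \<inter> X"
        using w unfolding P cylinder_def by (auto simp: le_max_iff_disj of_nat_max)
      then show ?thesis by (auto simp: E_def)
    qed (simp add: E_def)
  qed
  \<comment> \<open>A non-empty trace is determined by \<open>L\<close> and the word over
    \<open>A\<close> that one of its points carries on \<open>[-L, L]\<close>; each \<open>L\<close>
    admits finitely many such words.\<close>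
  have "E \<subseteq> insert {} (\<Union>L. (\<lambda>v. cylinder L v \<inter> X) ` Pi\<^sub>E {- int L..int L} (\<lambda>_. A))"
  proof
    fix P assume "P \<in> E"
    then consider "P = {}" | L v y where "P = cylinder L v \<inter> X" "y \<in> cylinder L v \<inter> X"
      by (auto simp: E_def)
    then show "P \<in> insert {} (\<Union>L. (\<lambda>v. cylinder L v \<inter> X) ` Pi\<^sub>E {- int L..int L} (\<lambda>_. A))"
    proof cases
      case 2
      have "restrict y {- int L..int L} \<in> Pi\<^sub>E {- int L..int L} (\<lambda>_. A)"
        using XA 2 by auto
      moreover have "P = cylinder L (restrict y {- int L..int L}) \<inter> X"
        using 2 by (auto simp: cylinder_def abs_le_iff)
      ultimately show ?thesis by blast
    qed simp
  qed
  moreover have "countable (insert {} (\<Union>L. (\<lambda>v. cylinder L v \<inter> X) ` Pi\<^sub>E {- int L..int L} (\<lambda>_. A)))"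
    using \<open>finite A\<close> by (intro countable_insert countable_UN countable_image
        countable_finite[OF finite_PiE]) auto
  ultimately have "countable E" by (rule countable_subset)
  have sets: "sets (restrict_space borel X) = sigma_sets X E"
  proof
    have "sets (restrict_space borel X) = (\<inter>) X ` sigma_sets UNIV {S. open S}"
      by (simp add: sets_restrict_space borel_def)
    also have "\<dots> = sigma_sets X ((\<inter>) X ` {S. open S})"
    proof (rule sigma_sets_Int)
      have "X \<in> sets borel" using \<open>closed X\<close> by simp
      then show "X \<in> sigma_sets UNIV {S. open S}" by (simp add: borel_def)
    qed simp
    also have "\<dots> \<subseteq> sigma_sets X E"
    proof (rule sigma_sets_mono, safe)
      fix U :: "(int \<Rightarrow> 'a) set" assume "open U"
      \<comment> \<open>Countability of \<open>E\<close> turns this into a countable union.\<close>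
      have "X \<inter> U = \<Union>{P\<in>E. P \<subseteq> U}"
      proof (intro equalityI subsetI)
        fix y assume "y \<in> X \<inter> U"
        then obtain L where "cylinder L y \<subseteq> U"
          using open_contains_cylinder \<open>open U\<close> by blast
        with \<open>y \<in> X \<inter> U\<close> have "cylinder L y \<inter> X \<in> {P\<in>E. P \<subseteq> U}" "y \<in> cylinder L y \<inter> X"
          by (auto simp: E_def cylinder_def)
        then show "y \<in> \<Union>{P\<in>E. P \<subseteq> U}" by blast
      qed (auto simp: E_def)
      moreover have "\<Union>{P\<in>E. P \<subseteq> U} \<in> sigma_sets X E"
        using \<open>countable E\<close> by (intro sigma_sets_UNION) (auto intro: countable_subset)
      ultimately show "X \<inter> U \<in> sigma_sets X E" by simp
    qed
    finally show "sets (restrict_space borel X) \<subseteq> sigma_sets X E" .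
    have "E \<subseteq> sets \<mu>"
      using cylinder_measurable[OF \<mu>] by (auto simp: E_def)
    then show "sigma_sets X E \<subseteq> sets (restrict_space borel X)"
      using \<mu> sets.sigma_sets_subset[of E \<mu>] space_invariant_prob[OF \<mu>]
      by (auto simp: invariant_prob_def)
  qed
  show ?thesis
  proof (rule measure_eqI_generator_eq_countable[of E X])
    show "emeasure \<mu> P = emeasure \<nu> P" if "P \<in> E" for P
      using that eq by (auto simp: E_def \<mu>.emeasure_eq_measure \<nu>.emeasure_eq_measure)
    show "sets \<mu> = sigma_sets X E" "sets \<nu> = sigma_sets X E"
      using \<mu> \<nu> sets by (auto simp: invariant_prob_def)
    \<comment> \<open>Cylinders of radius 0 already cover \<open>X\<close>, so \<open>E\<close>
      itself is a countable cover by sets of finite measure.\<close>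
    have "y \<in> \<Union>E" if "y \<in> X" for y
    proof (rule UnionI)
      show "cylinder 0 y \<inter> X \<in> E" by (auto simp: E_def)
      show "y \<in> cylinder 0 y \<inter> X" using that by (simp add: cylinder_def)
    qed
    then show "\<Union>E = X"
      by (auto simp: E_def)
  qed (use \<open>Int_stable E\<close> \<open>countable E\<close> in \<open>auto simp: E_def\<close>)
qed

section \<open>Word statistics along generic points\<close>

lemma funpow_shift: "(shift ^^ n) x j = x (j + int n)"
  by (induction n arbitrary: j) (simp_all add: shift_def algebra_simps)

lemma generic_frequency:
  fixes X :: "(int \<Rightarrow> 'a::discrete_topology) set"
  assumes "invariant_prob X \<mu>" "generic_point X \<mu> x"
  shows "(\<lambda>N. (1 / real N) * (\<Sum>n<N. indicator (cylinder L v) ((shift ^^ n) x)))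
           \<longlonglongrightarrow> measure \<mu> (cylinder L v \<inter> X)"
proof -
  have "(\<lambda>N. (1 / real N) * (\<Sum>n<N. indicator (cylinder L v) ((shift ^^ n) x)))
          \<longlonglongrightarrow> (\<integral>y. indicator (cylinder L v) y \<partial>\<mu>)"
    using assms(2) continuous_on_indicator_cylinder[of X L v] unfolding generic_point_def by blast
  then show ?thesis
    using space_invariant_prob[OF assms(1)] by simp
qed

text \<open>Distinct measures disagree on some cylinder, so its frequencies along \<open>x\<close>
  and \<open>y\<close> differ. Equal factors would force the same visits to it at all offsets with
  distance \<open>L\<close> from both ends, against \<open>cesaro_windows_differ\<close>.\<close>

lemma generic_factors_differ:
  fixes X :: "(int \<Rightarrow> 'a::discrete_topology) set"
  assumes "subshift A X" and \<mu>: "invariant_prob X \<mu>" "generic_point X \<mu> x"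
    and \<nu>: "invariant_prob X \<nu>" "generic_point X \<nu> y" and "\<mu> \<noteq> \<nu>" "\<delta> > 0"
  shows "\<forall>\<^sub>F n in sequentially. \<forall>s\<le>n. \<forall>s'\<le>n. \<forall>m. \<delta> * real n \<le> real m \<longrightarrow>
           factor (\<lambda>r. x (int r)) s m \<noteq> factor (\<lambda>r. y (int r)) s' m"
proof -
  obtain L v where neq: "measure \<mu> (cylinder L v \<inter> X) \<noteq> measure \<nu> (cylinder L v \<inter> X)"
    using invariant_prob_eqI[OF assms(1) \<mu>(1) \<nu>(1)] \<open>\<mu> \<noteq> \<nu>\<close> by blast
  define g where "g n = (indicator (cylinder L v) ((shift ^^ n) x) :: real)" for n
  define h where "h n = (indicator (cylinder L v) ((shift ^^ n) y) :: real)" for n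
  have "\<forall>\<^sub>F n in sequentially. \<forall>s\<le>n. \<forall>s'\<le>n. \<forall>m. \<delta> * real n \<le> real m \<longrightarrow>
           (\<exists>r. L \<le> r \<and> r + L < m \<and> g (s + r) \<noteq> h (s' + r))"
    using generic_frequency[OF \<mu>, of L v] generic_frequency[OF \<nu>, of L v] neq \<open>\<delta> > 0\<close>
    by (intro cesaro_windows_differ) (auto simp: g_def h_def indicator_def)
  moreover have "factor (\<lambda>r. x (int r)) s m \<noteq> factor (\<lambda>r. y (int r)) s' m"
    if r: "L \<le> r" "r + L < m" "g (s + r) \<noteq> h (s' + r)" for s s' m r
  proof
    assume eq: "factor (\<lambda>r. x (int r)) s m = factor (\<lambda>r. y (int r)) s' m"
    have "(shift ^^ (s + r)) x j = (shift ^^ (s' + r)) y j" if "\<bar>j\<bar> \<le> int L" for j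
    proof -
      \<comment> \<open>\<open>L \<le> r\<close> makes this index non-negative and
        \<open>r + L < m\<close> keeps it inside the factor.\<close>
      define l where "l = nat (int r + j)"
      have l: "int l = int r + j" "l < m" using that r by (auto simp: l_def)
      have "x (int (s + l)) = y (int (s' + l))"
        using eq l(2) unfolding factor_eq_iff by blast
      then show ?thesis using l by (simp add: funpow_shift algebra_simps)
    qed
    then have "(shift ^^ (s + r)) x \<in> cylinder L v \<longleftrightarrow> (shift ^^ (s' + r)) y \<in> cylinder L v"
      by (simp add: cylinder_def)
    with r(3) show False by (simp add: g_def h_def indicator_def)
  qed
  ultimately show ?thesis by (smt (verit, best) eventually_mono)
qed

section \<open>Eventually periodic generic points\<close>

text \<open>The orbit visits every cylinder around its periodic limit \<open>y\<close> with a
  frequency bounded below independently of the radius. These cylinders shrink to \<open>y\<close>,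
  which is therefore an atom.\<close>

lemma eventually_periodic_atomic:
  fixes X :: "(int \<Rightarrow> 'a::discrete_topology) set"
  assumes \<mu>: "invariant_prob X \<mu>" "generic_point X \<mu> x"
    and "t > 0" and per: "\<And>r. p \<le> r \<Longrightarrow> x (int (r + t)) = x (int r)"
  shows "\<not> nonatomic \<mu>"
proof -
  interpret prob_space \<mu> using \<mu> by (simp add: invariant_prob_def)
  \<comment> \<open>Extends the periodic tail to both sides; \<open>mod\<close> stays in
    \<open>{0..<t}\<close> for negative \<open>j\<close> too.\<close>
  define y where "y j = x (int p + j mod int t)" for j
  have per': "x (int (r + s * t)) = x (int r)" if "p \<le> r" for r s
  proof (induction s)
    case (Suc s)
    then show ?case using per[of "r + s * t"] that by (simp add: algebra_simps)
  qed simp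
  \<comment> \<open>For \<open>s \<ge> L\<close> the window of radius \<open>L\<close> around
    \<open>p + s * t\<close> lies in the periodic part.\<close>
  have visit: "(shift ^^ (p + s * t)) x \<in> cylinder L y" if "L \<le> s" for s L
    unfolding cylinder_def
  proof (intro CollectI allI impI)
    fix j assume j: "\<bar>j\<bar> \<le> int L"
    have "s \<le> s * t" using \<open>t > 0\<close> by simp
    then have "int L \<le> int s * int t" using that by (metis of_nat_le_iff of_nat_mult order_trans)
    define u where "u = nat (j + int s * int t)"
    have u: "int u = j + int s * int t"
      using j \<open>int L \<le> int s * int t\<close> by (simp add: u_def)
    have "(shift ^^ (p + s * t)) x j = x (int (p + u))"
      using u by (simp add: funpow_shift algebra_simps)
    also have "\<dots> = x (int (p + u mod t + (u div t) * t))"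
      by (simp add: add.assoc)
    also have "\<dots> = x (int (p + u mod t))"
      by (rule per') simp
    also have "\<dots> = y j"
      by (simp add: y_def zmod_int u)
    finally show "(shift ^^ (p + s * t)) x j = y j" .
  qed
  \<comment> \<open>This is what \<open>K / 2\<close> visits within at most
    \<open>K * (t + 1)\<close> steps guarantee.\<close>
  define c where "c = 1 / (2 * (real t + 1))"
  have "c > 0" by (simp add: c_def add_pos_pos)
  have mass: "c \<le> measure \<mu> (cylinder L y \<inter> X)" for L
  proof -
    define F where "F N = (1 / real N) * (\<Sum>n<N. indicator (cylinder L y) ((shift ^^ n) x))" for N
    have "strict_mono (\<lambda>K. p + K * t)"
      using \<open>t > 0\<close> by (simp add: strict_mono_def)
    from LIMSEQ_subseq_LIMSEQ[OF generic_frequency[OF \<mu>] this]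
    have lim: "(\<lambda>K. F (p + K * t)) \<longlonglongrightarrow> measure \<mu> (cylinder L y \<inter> X)"
      by (simp add: F_def o_def)
    \<comment> \<open>\<open>K \<ge> 2 * L\<close> leaves at least \<open>K / 2\<close> values of
      \<open>s\<close> in \<open>{L..<K}\<close>, and \<open>K \<ge> p\<close> gives
      \<open>p + K * t \<le> K * (t + 1)\<close>.\<close>
    have "c \<le> F (p + K * t)" if K: "K \<ge> p + 2 * L + 1" for K
    proof -
      have inj: "inj_on (\<lambda>s. p + s * t) {L..<K}"
        using \<open>t > 0\<close> by (auto simp: inj_on_def)
      have "real K / 2 \<le> (\<Sum>s\<in>{L..<K}. 1)"
        using K by simp
      also have "\<dots> = (\<Sum>s\<in>{L..<K}. indicator (cylinder L y) ((shift ^^ (p + s * t)) x))"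
        using visit by (intro sum.cong) auto
      also have "\<dots> = (\<Sum>n\<in>(\<lambda>s. p + s * t) ` {L..<K}. indicator (cylinder L y) ((shift ^^ n) x))"
        by (simp add: sum.reindex[OF inj])
      also have "\<dots> \<le> (\<Sum>n<p + K * t. indicator (cylinder L y) ((shift ^^ n) x))"
        using \<open>t > 0\<close> by (intro sum_mono2) auto
      finally have sum: "real K / 2 \<le> (\<Sum>n<p + K * t. indicator (cylinder L y) ((shift ^^ n) x))" .
      have N: "0 < real (p + K * t)" "real (p + K * t) \<le> real K * (real t + 1)"
      proof -
        have "0 < K * t" using K \<open>t > 0\<close> by simp
        then show "0 < real (p + K * t)" by linarith
        have "p + K * t \<le> K * (t + 1)" using K by simp
        then show "real (p + K * t) \<le> real K * (real t + 1)"
          by (metis of_nat_1 of_nat_add of_nat_le_iff of_nat_mult)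
      qed
      have "c = (real K / 2) / (real K * (real t + 1))"
        using K by (simp add: c_def)
      also have "\<dots> \<le> (real K / 2) / real (p + K * t)"
        using N K by (intro divide_left_mono mult_pos_pos) auto
      also have "\<dots> \<le> F (p + K * t)"
        using divide_right_mono[OF sum, of "real (p + K * t)"] by (simp add: F_def)
      finally show ?thesis .
    qed
    then show ?thesis by (intro LIMSEQ_le_const[OF lim]) blast
  qed
  have "(\<lambda>L. measure \<mu> (cylinder L y \<inter> X)) \<longlonglongrightarrow> measure \<mu> (\<Inter>L. cylinder L y \<inter> X)"
    using cylinder_measurable[OF \<mu>(1)]
    by (intro finite_Lim_measure_decseq) (auto simp: decseq_def cylinder_def)
  then have "c \<le> measure \<mu> (\<Inter>L. cylinder L y \<inter> X)"
    using mass by (intro LIMSEQ_le_const) auto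
  moreover have "(\<Inter>L. cylinder L y \<inter> X) = {y} \<inter> X"
  proof (intro equalityI subsetI)
    fix w assume w: "w \<in> (\<Inter>L. cylinder L y \<inter> X)"
    then have "w j = y j" for j
      by (auto simp: cylinder_def dest!: spec[of _ "nat \<bar>j\<bar>"])
    with w show "w \<in> {y} \<inter> X" by auto
  qed (auto simp: cylinder_def)
  ultimately have "measure \<mu> ({y} \<inter> X) > 0" using \<open>c > 0\<close> by simp
  \<comment> \<open>Positive mass excludes an empty intersection.\<close>
  moreover from this have "y \<in> X" by (cases "y \<in> X") auto
  ultimately have "y \<in> space \<mu>" "emeasure \<mu> {y} \<noteq> 0"
    using space_invariant_prob[OF \<mu>(1)] by (auto simp: emeasure_eq_measure)
  then show ?thesis by (auto simp: nonatomic_def)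
qed

section \<open>Counting words of the subshift\<close>

lemma finite_words:
  assumes "subshift A X"
  shows "finite (words X n)"
proof (rule finite_subset)
  show "words X n \<subseteq> {w. set w \<subseteq> A \<and> length w = n}"
    using assms by (fastforce simp: words_def subshift_def)
  show "finite {w. set w \<subseteq> A \<and> length w = n}"
    using assms by (simp add: subshift_def finite_lists_length_eq)
qed

theorem theorem1p1:
  fixes A :: "'a::discrete_topology set" and X :: "(int \<Rightarrow> 'a) set" and k :: nat
  assumes "subshift A X"
    and "liminf (\<lambda>n. ereal (real (complexity X n) / real n)) < ereal (real k)"
  shows "finite {\<mu>. generic_measure X \<mu> \<and> nonatomic \<mu>} \<and>
         card {\<mu>. generic_measure X \<mu> \<and> nonatomic \<mu>} \<le> k - 1"
proof (rule ccontr)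
  define M where "M = {\<mu>. generic_measure X \<mu> \<and> nonatomic \<mu>}"
  assume "\<not> ?thesis"
  then have "infinite M \<or> k \<le> card M" by (auto simp: M_def)
  then obtain S where S: "S \<subseteq> M" "finite S" "card S = k"
    by (metis infinite_arbitrarily_large obtain_subset_with_card_n)
  obtain c where c: "liminf (\<lambda>n. ereal (real (complexity X n) / real n)) < ereal c" "c < real k"
    using ereal_dense2[OF assms(2)] by auto
  have freq: "\<exists>\<^sub>F n in sequentially. real (complexity X n) / real n < c"
  proof (rule ccontr)
    assume "\<not> ?thesis"
    then have "\<forall>\<^sub>F n in sequentially. ereal c \<le> ereal (real (complexity X n) / real n)"
      by (simp add: frequently_def not_less)
    from Liminf_bounded[OF this] c(1) show False by simp
  qed
  from frequently_ex[OF freq] obtain n0 where "real (complexity X n0) / real n0 < c" by blast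
  \<comment> \<open>Complexity quotients are non-negative, so \<open>0 \<le> c < k\<close> rules out
    \<open>k = 0\<close>.\<close>
  then have "0 \<le> c" by (rule order_trans[OF _ less_imp_le, rotated]) simp
  with c(2) have "k > 0" by simp
  \<comment> \<open>The words lost, about \<open>k * \<delta> * n\<close>, cost half of the gap
    \<open>(k - c) * n\<close>; the other half pays for rounding in \<open>m\<close>.\<close>
  define \<delta> where "\<delta> = (real k - c) / (2 * real k)"
  have \<delta>: "0 < \<delta>" "\<delta> \<le> 1 / 2" "real k * \<delta> = (real k - c) / 2"
    using c(2) \<open>0 \<le> c\<close> \<open>k > 0\<close> by (auto simp: \<delta>_def field_simps)
  have "\<forall>\<mu>\<in>S. \<exists>x. generic_point X \<mu> x"
    using S(1) by (auto simp: M_def generic_measure_def)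
  then obtain x where x: "\<And>\<mu>. \<mu> \<in> S \<Longrightarrow> generic_point X \<mu> (x \<mu>)" by metis
  have inv: "invariant_prob X \<mu>" and na: "nonatomic \<mu>" if "\<mu> \<in> S" for \<mu>
    using that S(1) by (auto simp: M_def generic_measure_def)
  define z where "z \<mu> r = x \<mu> (int r)" for \<mu> r
  have ev: "\<forall>\<^sub>F n in sequentially. \<forall>\<mu>\<in>S. \<forall>\<nu>\<in>S. \<mu> \<noteq> \<nu> \<longrightarrow> (\<forall>s\<le>n. \<forall>s'\<le>n. \<forall>m. \<delta> * real n \<le> real m \<longrightarrow>
           factor (z \<mu>) s m \<noteq> factor (z \<nu>) s' m)"
  proof (intro eventually_ball_finite[OF S(2)] ballI)
    fix \<mu> \<nu> assume "\<mu> \<in> S" "\<nu> \<in> S"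
    then show "\<forall>\<^sub>F n in sequentially. \<mu> \<noteq> \<nu> \<longrightarrow> (\<forall>s\<le>n. \<forall>s'\<le>n. \<forall>m. \<delta> * real n \<le> real m \<longrightarrow>
           factor (z \<mu>) s m \<noteq> factor (z \<nu>) s' m)"
      using generic_factors_differ[OF assms(1) inv x inv x _ \<delta>(1), of \<mu> \<nu>] unfolding z_def[abs_def]
      by (cases "\<mu> = \<nu>") auto
  qed
  \<comment> \<open>The quotient beats the rounding loss \<open>k\<close>; the added 2 ensures
    \<open>m \<le> n / 2 + 1 \<le> n\<close>.\<close>
  have ev': "\<forall>\<^sub>F n in sequentially. real n \<ge> 2 * real k / (real k - c) + 2"
    by (rule eventually_sequentiallyI[of "nat \<lceil>2 * real k / (real k - c) + 2\<rceil>"]) linarith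
  obtain n where n: "real (complexity X n) / real n < c"
      "real n \<ge> 2 * real k / (real k - c) + 2"
    and differ: "\<forall>\<mu>\<in>S. \<forall>\<nu>\<in>S. \<mu> \<noteq> \<nu> \<longrightarrow> (\<forall>s\<le>n. \<forall>s'\<le>n. \<forall>m. \<delta> * real n \<le> real m \<longrightarrow>
        factor (z \<mu>) s m \<noteq> factor (z \<nu>) s' m)"
    using frequently_ex[OF frequently_eventually_conj[OF freq eventually_conj[OF ev ev']]] by blast
  have "2 * real k / (real k - c) \<ge> 0" using c(2) by simp
  then have n2: "real n \<ge> 2" using n(2) by linarith
  define m where "m = nat \<lceil>\<delta> * real n\<rceil>"
  have m: "\<delta> * real n \<le> real m" "real m \<le> \<delta> * real n + 1"
    using \<delta>(1) mult_nonneg_nonneg[of \<delta> "real n"] unfolding m_def by linarith+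
  have "\<delta> * real n \<le> 1 / 2 * real n" using \<delta>(2) by (intro mult_right_mono) auto
  with m(2) n2 have "m \<le> n" by linarith
  have "\<exists>W. finite W \<and> n - m \<le> card W \<and> (\<forall>w\<in>W. \<exists>i. w = factor (z \<mu>) i n) \<and>
            (\<forall>w\<in>W. \<exists>s<n. take m w = factor (z \<mu>) s m)" if "\<mu> \<in> S" for \<mu>
  proof (intro many_factors \<open>m \<le> n\<close>)
    show "\<exists>r\<ge>p. z \<mu> (r + t) \<noteq> z \<mu> r" if "t > 0" for p t
      using eventually_periodic_atomic[OF inv x that] na \<open>\<mu> \<in> S\<close> unfolding z_def by blast
  qed
  then obtain W where W: "\<And>\<mu>. \<mu> \<in> S \<Longrightarrow> finite (W \<mu>)" "\<And>\<mu>. \<mu> \<in> S \<Longrightarrow> n - m \<le> card (W \<mu>)"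
      "\<And>\<mu> w. \<mu> \<in> S \<Longrightarrow> w \<in> W \<mu> \<Longrightarrow> \<exists>i. w = factor (z \<mu>) i n"
      "\<And>\<mu> w. \<mu> \<in> S \<Longrightarrow> w \<in> W \<mu> \<Longrightarrow> \<exists>s<n. take m w = factor (z \<mu>) s m"
    by metis
  have disj: "W \<mu> \<inter> W \<nu> = {}" if "\<mu> \<in> S" "\<nu> \<in> S" "\<mu> \<noteq> \<nu>" for \<mu> \<nu>
  proof (rule ccontr)
    assume "W \<mu> \<inter> W \<nu> \<noteq> {}"
    then obtain w where "w \<in> W \<mu>" "w \<in> W \<nu>" by blast
    with W(4) that obtain s s' where "s < n" "s' < n" "factor (z \<mu>) s m = factor (z \<nu>) s' m"
      by metis
    with differ that m(1) show False by (meson less_imp_le)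
  qed
  have "(\<Union>\<mu>\<in>S. W \<mu>) \<subseteq> words X n"
  proof clarify
    fix \<mu> w assume "\<mu> \<in> S" "w \<in> W \<mu>"
    with W(3) obtain i where "w = map (\<lambda>j. x \<mu> (int i + int j)) [0..<n]"
      by (fastforce simp: factor_def z_def)
    moreover have "x \<mu> \<in> X" using x \<open>\<mu> \<in> S\<close> by (simp add: generic_point_def)
    ultimately show "w \<in> words X n" by (auto simp: words_def)
  qed
  \<comment> \<open>Finiteness of the set of words matters, as \<open>card\<close> is 0 on infinite
    sets.\<close>
  then have "card (\<Union>\<mu>\<in>S. W \<mu>) \<le> complexity X n"
    unfolding complexity_def using finite_words[OF assms(1)] by (rule card_mono[rotated])
  moreover have "card (\<Union>\<mu>\<in>S. W \<mu>) = (\<Sum>\<mu>\<in>S. card (W \<mu>))"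
    using S(2) W(1) disj by (intro card_UN_disjoint) auto
  moreover have "k * (n - m) \<le> (\<Sum>\<mu>\<in>S. card (W \<mu>))"
    using sum_bounded_below[of S "n - m" "\<lambda>\<mu>. card (W \<mu>)"] W(2) S(3) by simp
  ultimately have "k * (n - m) \<le> complexity X n" by linarith
  \<comment> \<open>With \<open>m \<le> \<delta> * n + 1\<close> this leads to
    \<open>(k - c) * n < 2 * k\<close>, contrary to the choice of \<open>n\<close>.\<close>
  then have "real k * (real n - real m) \<le> real (complexity X n)"
    using \<open>m \<le> n\<close> by (metis of_nat_diff of_nat_le_iff of_nat_mult)
  also have "\<dots> < c * real n"
    using n(1) n2 by (simp add: field_simps)
  finally have "real k * real n < c * real n + real k * real m"
    by (simp add: algebra_simps)
  also have "\<dots> \<le> c * real n + real k * (\<delta> * real n + 1)"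
    using m(2) by (intro add_left_mono mult_left_mono) auto
  also have "\<dots> = c * real n + (real k - c) / 2 * real n + real k"
    using \<delta>(3) by (simp add: distrib_left mult.assoc[symmetric])
  finally have "(real k - c) * real n < 2 * real k"
    by (simp add: field_simps)
  moreover have "2 * real k \<le> (real k - c) * real n"
  proof -
    have "2 * real k / (real k - c) \<le> real n" using n(2) by simp
    then show ?thesis using c(2) by (simp add: pos_divide_le_eq mult.commute)
  qed
  ultimately show False by simp
qed

end
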